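(* Let $n,k\ge 1$ and let ${\bf C}=(C_0,C_1,\dots,C_k)$ be a $(k+1)$-tuple of real $n\times n$ matrices having the column $W_0$-property. Let $q\in\mathbb{R}^n$ and ${\bf d}\in(\mathbb{R}^n_{++})^{k-1}$. If $\mathrm{SOL}({\bf C},{\bf d},q)$ has a bounded connected component, then $\mathrm{SOL}({\bf C},{\bf d},q)$ is connected.
   Context: Notation: $\mathbb{R}^n_{++}$ is the set of vectors in $\mathbb{R}^n$ with all entries positive; $x\wedge y$ is the componentwise minimum of $x,y\in\mathbb{R}^n$. Extended horizontal linear complementarity problem: given ${\bf C}=(C_0,\dots,C_k)$ with $C_i\in\mathbb{R}^{n\times n}$, $q\in\mathbb{R}^n$ and ${\bf d}=(d_1,\dots,d_{k-1})\in(\mathbb{R}^n_{++})^{k-1}$ (empty if $k=1$), $\mathrm{EHLCP}({\bf C},{\bf d},q)$ asks for $(x_0,x_1,\dots,x_k)\in(\mathbb{R}^n)^{k+1}$ with $$C_0x_0=q+\sum_{i=1}^k C_ix_i,\qquad x_0\wedge x_1=0,\qquad (d_j-x_j)\wedge x_{j+1}=0\ \ (1\le j\le k-1).$$ $\mathrm{SOL}({\bf C},{\bf d},q)\subseteq(\mathbb{R}^n)^{k+1}$ denotes the set of all its solutions. A matrix $R\in\mathbb{R}^{n\times n}$ is a column representative of ${\bf C}$ if for each $j\in\{1,\dots,n\}$ the $j$-th column of $R$ is the $j$-th column of one of $C_0,\dots,C_k$. ${\bf C}$ has the column $W$-property if the determinants of all column representatives of ${\bf C}$ are all positive or all negative.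 ${\bf C}$ has the column $W_0$-property if there exists a tuple ${\bf N}=(N_0,\dots,N_k)$ of real $n\times n$ matrices such that $(C_0+\epsilon N_0,C_1+\epsilon N_1,\dots,C_k+\epsilon N_k)$ has the column $W$-property for all $\epsilon>0$. *)

theory Defs
  imports "HOL-Analysis.Analysis"
begin

text \<open>
  A tuple indexed by \<open>0, \<dots>, k\<close> is represented by a function on \<^typ>\<open>nat\<close>. For the matrix
  tuples and for \<open>d = (d 1, \<dots>, d (k - 1))\<close> the values at other indices are never inspected.
\<close>

definition column_representative ::
    "nat \<Rightarrow> (nat \<Rightarrow> real^'n^'n) \<Rightarrow> real^'n^'n \<Rightarrow> bool" where
  "column_representative k C R \<longleftrightarrow> (\<forall>j. \<exists>i\<le>k. column j R = column j (C i))"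

definition column_W :: "nat \<Rightarrow> (nat \<Rightarrow> real^'n^'n) \<Rightarrow> bool" where
  "column_W k C \<longleftrightarrow>
     (\<forall>R. column_representative k C R \<longrightarrow> det R > 0) \<or>
     (\<forall>R. column_representative k C R \<longrightarrow> det R < 0)"

definition column_W0 :: "nat \<Rightarrow> (nat \<Rightarrow> real^'n^'n) \<Rightarrow> bool" where
  "column_W0 k C \<longleftrightarrow>
     (\<exists>N :: nat \<Rightarrow> real^'n^'n. \<forall>\<epsilon>>0. column_W k (\<lambda>i. C i + \<epsilon> *\<^sub>R N i))"

text \<open>
  Solutions are extensional functions on \<open>{..k}\<close> (value \<^const>\<open>undefined\<close> at indices above \<open>k\<close>),
  so that \<open>{..k} \<rightarrow>\<^sub>E UNIV\<close>, with the topology induced by the product topology of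
  \<^typ>\<open>nat \<Rightarrow> real^'n\<close>, is a copy of the \<open>(k + 1)\<close>-fold power of \<^typ>\<open>real^'n\<close>.
  The lattice operation \<^const>\<open>inf\<close> on \<^typ>\<open>real^'n\<close> is the componentwise minimum.
\<close>

definition SOL ::
    "nat \<Rightarrow> (nat \<Rightarrow> real^'n^'n) \<Rightarrow> (nat \<Rightarrow> real^'n) \<Rightarrow> real^'n \<Rightarrow> (nat \<Rightarrow> real^'n) set" where
  "SOL k C d q = {x \<in> {..k} \<rightarrow>\<^sub>E UNIV.
     C 0 *v x 0 = q + (\<Sum>i=1..k. C i *v x i) \<and>
     inf (x 0) (x 1) = 0 \<and>
     (\<forall>j\<in>{1..<k}. inf (d j - x j) (x (Suc j)) = 0)}"

text \<open>
  The library metric on \<^typ>\<open>nat \<Rightarrow> real^'n\<close> induces the product topology but is itself bounded,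
  so \<^const>\<open>bounded\<close> would hold of every set of tuples. Boundedness in the \<open>(k + 1)\<close>-fold power of
  \<^typ>\<open>real^'n\<close> is therefore expressed through the coordinate projections.
\<close>

definition bounded_tuples :: "nat \<Rightarrow> (nat \<Rightarrow> real^'n) set \<Rightarrow> bool" where
  "bounded_tuples k T \<longleftrightarrow> (\<forall>i\<le>k. bounded ((\<lambda>x. x i) ` T))"

end

theory Submission imports Defs begin

text \<open>
  For each coordinate, the complementarity conditions describe a polygonal line, which we
  parametrize by a real number; this turns the problem into an equation \<open>G t = - q\<close> on
  \<open>\<real>\<^sup>n\<close>, where \<open>G\<close> is a sum of functions of the single coordinates \<open>t j\<close>, each with piecewise
  constant derivative taken from the \<open>j\<close>-th columns of the \<open>C i\<close>. Under the column \<open>W\<close>-property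
  \<open>G\<close> is injective, since the determinant is multilinear; under the \<open>W\<^sub>0\<close>-property it is a locally
  uniform limit of injective maps.

  For such a limit \<open>G\<close>, suppose a fibre has a compact component \<open>K\<close> and a further point \<open>z\<close>.
  Enclose \<open>K\<close> in a bounded open set \<open>U\<close> whose closure misses \<open>z\<close> and whose boundary misses the
  fibre. By invariance of domain, the image of \<open>U\<close> under a sufficiently close injective \<open>g\<close> is
  relatively clopen in a small ball around the value, hence contains the ball and so \<open>g z\<close>, which
  contradicts injectivity. Thus the fibre is \<open>K\<close>.
\<close>

section \<open>Limits of injective maps\<close>

theorem connected_vimage_of_injective_limit:
  fixes f :: "'a::euclidean_space \<Rightarrow> 'a"
  assumes contf: "continuous_on UNIV f"
    and approx: "\<And>S e. compact S \<Longrightarrow> 0 < e \<Longrightarrow>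
      \<exists>g. continuous_on UNIV g \<and> inj g \<and> (\<forall>x\<in>S. dist (g x) (f x) < e)"
    and K: "K \<in> components {x. f x = c}" and bK: "bounded K"
  shows "connected {x. f x = c}"
proof -
  let ?Z = "{x. f x = c}"
  have clZ: "closed ?Z"
    using continuous_closed_preimage_constant[OF contf closed_UNIV] by simp
  have cK: "compact K"
    using closed_components[OF clZ K] bK by (simp add: compact_eq_bounded_closed)
  have K_sub: "K \<noteq> {}" "K \<subseteq> ?Z" "connected K"
    using K by (rule in_components_nonempty in_components_subset in_components_connected)+
  have "z \<in> K" if z: "f z = c" for z
  proof (rule ccontr)
    assume zK: "z \<notin> K"
    \<comment> \<open>\<open>K\<close> need not be relatively open in the fibre; by Sura-Bura it has
      a compact, relatively clopen neighbourhood \<open>A\<close> there that avoids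
      \<open>z\<close>.\<close>
    obtain A where A: "openin (top_of_set ?Z) A" "compact A" "K \<subseteq> A" "A \<subseteq> - {z}"
      using Sura_Bura_clopen_subset[OF closed_imp_locally_compact[OF clZ] K cK, of "- {z}"] zK
      by auto
    obtain T where T: "open T" "A = ?Z \<inter> T"
      using A(1) by (auto simp: openin_open)
    have clB: "closed (?Z - A)"
    proof -
      have "?Z - A = ?Z \<inter> - T" using T by auto
      then show ?thesis using clZ T(1) by (simp add: closed_Int closed_Compl)
    qed
    obtain r where r: "r > 0" "\<And>x y. x \<in> A \<Longrightarrow> y \<in> ?Z - A \<Longrightarrow> r \<le> dist x y"
      using separate_compact_closed[OF A(2) clB] by auto
    \<comment> \<open>The radius is below the distance \<open>r\<close> from \<open>A\<close> to the
      rest of the fibre, so even the closed neighbourhood \<open>V\<close> meets the fibre only in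
      \<open>A\<close>.\<close>
    define U where "U = (\<Union>x\<in>A. ball x (r/2))"
    define V where "V = (\<Union>x\<in>A. cball x (r/2))"
    have "open U" by (auto simp: U_def)
    have "A \<subseteq> U" using r(1) by (force simp: U_def)
    have "U \<subseteq> V" by (force simp: U_def V_def)
    have "compact V"
      unfolding V_def by (rule compact_minkowski_sum_cball[OF A(2)])
    have V_Z: "x \<in> A" if x: "x \<in> V" "f x = c" for x
    proof (rule ccontr)
      assume "x \<notin> A"
      obtain y where "y \<in> A" "dist y x \<le> r/2" using x by (auto simp: V_def)
      then show False using r(2)[of y x] r(1) x \<open>x \<notin> A\<close> by auto
    qed
    have zV: "z \<notin> V" using V_Z z A(4) by blast
    define F where "F = V - U"
    have "compact F" unfolding F_def using \<open>compact V\<close> \<open>open U\<close> by (rule compact_diff)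
    have "c \<notin> f ` F" using V_Z \<open>A \<subseteq> U\<close> by (auto simp: F_def)
    moreover have "closed (f ` F)"
      using compact_continuous_image[OF continuous_on_subset[OF contf] \<open>compact F\<close>]
      by (simp add: compact_imp_closed)
    ultimately obtain \<delta> where \<delta>: "\<delta> > 0" "\<And>x. x \<in> F \<Longrightarrow> \<delta> \<le> dist c (f x)"
      using separate_point_closed by (metis imageI)
    \<comment> \<open>On \<open>F\<close>, \<open>g\<close> stays more than 3/4 of
      \<open>\<delta>\<close> away from \<open>c\<close>; on \<open>K\<close> and at
      \<open>z\<close> it is within \<open>\<delta>/4\<close>. The radius \<open>\<delta>/2\<close>
      of the ball lies in between.\<close>
    obtain g where g: "continuous_on UNIV g" "inj g" "\<And>x. x \<in> insert z V \<Longrightarrow> dist (g x) (f x) < \<delta>/4"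
      using approx[of "insert z V" "\<delta>/4"] \<open>compact V\<close> \<delta>(1) by (auto simp: compact_insert)
    let ?B = "ball c (\<delta>/2)"
    have F_out: "g x \<notin> ?B" if "x \<in> F" for x
    proof -
      have "dist (g x) (f x) < \<delta>/4" using that g(3) by (simp add: F_def)
      then show ?thesis using \<delta>(2)[OF that] \<delta>(1) dist_triangle[of c "f x" "g x"] by auto
    qed
    have "open (g ` U)"
      using invariance_of_domain[of U g] g \<open>open U\<close>
      by (meson continuous_on_subset inj_on_subset subset_UNIV)
    have "closed (g ` V)"
      using compact_continuous_image[OF continuous_on_subset[OF g(1)] \<open>compact V\<close>]
      by (simp add: compact_imp_closed)
    have cover: "?B \<subseteq> g ` U \<union> - (g ` V)"
      using F_out unfolding F_def by blast
    have disj: "g ` U \<inter> - (g ` V) \<inter> ?B = {}" using \<open>U \<subseteq> V\<close> by blast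
    obtain x where x: "x \<in> K" using K_sub by blast
    then have "x \<in> U" "f x = c" using A(3) \<open>A \<subseteq> U\<close> K_sub by auto
    then have "g x \<in> ?B" using g(3)[of x] \<open>U \<subseteq> V\<close> \<delta>(1) by (auto simp: dist_commute)
    moreover have "g z \<in> ?B" using g(3)[of z] z \<delta>(1) by (auto simp: dist_commute)
    moreover have "g z \<notin> g ` V" using zV g(2) by (auto dest: injD)
    ultimately show False
      using connectedD[OF connected_ball \<open>open (g ` U)\<close> open_Compl[OF \<open>closed (g ` V)\<close>] disj cover]
        \<open>x \<in> U\<close> by blast
  qed
  then have "?Z = K" using K_sub by auto
  then show ?thesis using K_sub by simp
qed

section \<open>Convex combinations of columns\<close>

text \<open>Linearity of the determinant in each column, applied to one column at a time, yields a
  convex combination of determinants of representatives. The factor \<open>\<sigma>\<close> treats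
  both signs at once.\<close>

lemma det_convex_columns_pos:
  fixes C :: "nat \<Rightarrow> real^'n^'n" and w :: "nat \<Rightarrow> 'n \<Rightarrow> real"
  assumes rep: "\<And>R. column_representative k C R \<Longrightarrow> 0 < \<sigma> * det R"
    and w0: "\<And>i j. i \<le> k \<Longrightarrow> 0 \<le> w i j" and w1: "\<And>j. (\<Sum>i\<le>k. w i j) = 1"
  shows "0 < \<sigma> * det (\<chi> a j. \<Sum>i\<le>k. w i j * C i $ a $ j)"
proof -
  \<comment> \<open>Columns are stored as rows, so that row expansions of \<open>det\<close> apply.
    Those in \<open>S\<close> are already averaged; \<open>r\<close> selects the others.\<close>
  define A where "A S r = (\<chi> j. if j \<in> S then \<Sum>i\<le>k. w i j *s column j (C i)
    else column j (C (r j)))" for S and r :: "'n \<Rightarrow> nat"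
  have main: "0 < \<sigma> * det (A S r)" if "finite S" "\<forall>j. r j \<le> k" for S r
    using that
  proof (induction S arbitrary: r rule: finite_induct)
    case empty
    have "column_representative k C (transpose (A {} r))"
      using empty by (auto simp: column_representative_def A_def column_def transpose_def)
    then show ?case using rep by (metis det_transpose)
  next
    case (insert b S)
    have "A (insert b S) r = (\<chi> j. if j = b then \<Sum>i\<le>k. w i j *s column j (C i) else A S r $ j)"
      by (auto simp: A_def vec_eq_iff)
    then have "det (A (insert b S) r) =
        (\<Sum>i\<le>k. det (\<chi> j. if j = b then w i j *s column j (C i) else A S r $ j))"
      by (simp add: det_linear_row_sum)
    also have "\<dots> = (\<Sum>i\<le>k. w i b * det (A S (r(b := i))))"
    proof (rule sum.cong[OF refl])
      fix i
      have "(\<chi> j. if j = b then w i j *s column j (C i) else A S r $ j)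
          = (\<chi> j. if j = b then w i b *s column j (C i) else A S r $ j)"
        by (simp add: vec_eq_iff)
      moreover have "A S (r(b := i)) = (\<chi> j. if j = b then column j (C i) else A S r $ j)"
        using insert by (auto simp: A_def vec_eq_iff)
      ultimately show "det (\<chi> j. if j = b then w i j *s column j (C i) else A S r $ j)
          = w i b * det (A S (r(b := i)))"
        by (simp add: det_row_mul)
    qed
    finally have eq: "\<sigma> * det (A (insert b S) r) = (\<Sum>i\<le>k. w i b * (\<sigma> * det (A S (r(b := i)))))"
      by (simp add: sum_distrib_left mult.left_commute)
    have pos: "0 < \<sigma> * det (A S (r(b := i)))" if "i \<le> k" for i
      by (rule insert.IH) (use insert.prems that in simp)
    obtain i where i: "i \<le> k" "w i b \<noteq> 0"
      using w1[of b] by (metis atMost_iff sum.neutral zero_neq_one)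
    have "0 < (\<Sum>i\<le>k. w i b * (\<sigma> * det (A S (r(b := i)))))"
    proof (rule sum_pos2[of _ i])
      show "0 < w i b * (\<sigma> * det (A S (r(b := i))))"
        using i w0[of i b] pos by (simp add: order_less_le)
      show "0 \<le> w i b * (\<sigma> * det (A S (r(b := i))))" if "i \<in> {..k}" for i
        using that w0[of i b] pos[of i] by (simp add: less_imp_le)
    qed (use i in auto)
    then show ?case using eq by simp
  qed
  have "(\<chi> a j. \<Sum>i\<le>k. w i j * C i $ a $ j) = transpose (A UNIV (\<lambda>_. 0))"
    by (simp add: A_def vec_eq_iff transpose_def column_def)
  then show ?thesis using main[of UNIV "\<lambda>_. 0"] by (simp add: det_transpose)
qed

text \<open>
  The increment of the map from \<open>s\<close> to \<open>t\<close> is \<open>M *v (t - s)\<close>, where each column of \<open>M\<close> is a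
  convex combination of the corresponding columns of the \<open>C i\<close>, with weights
  \<open>(y t i - y s i) / (t - s)\<close>.
\<close>

lemma column_W_inj:
  fixes C :: "nat \<Rightarrow> real^'n^'n" and y :: "real^'n \<Rightarrow> nat \<Rightarrow> real^'n"
  assumes W: "column_W k C"
    and mono: "\<And>s t i j. i \<le> k \<Longrightarrow> s $ j \<le> t $ j \<Longrightarrow> y s i $ j \<le> y t i $ j"
    and total: "\<And>t. (\<Sum>i\<le>k. y t i) = t"
  shows "inj (\<lambda>t. \<Sum>i\<le>k. C i *v y t i)"
proof (rule injI)
  fix s t assume eq: "(\<Sum>i\<le>k. C i *v y s i) = (\<Sum>i\<le>k. C i *v y t i)"
  obtain \<sigma> where \<sigma>: "\<And>R. column_representative k C R \<Longrightarrow> 0 < \<sigma> * det R"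
  proof -
    from W consider "\<forall>R. column_representative k C R \<longrightarrow> det R > 0"
      | "\<forall>R. column_representative k C R \<longrightarrow> det R < 0"
      unfolding column_W_def by blast
    then show thesis
      by cases (use that[of 1] that[of "-1"] in auto)
  qed
  \<comment> \<open>Where the coordinates agree, any convex weights serve; all weight is put on
    index 0.\<close>
  define w where "w i j = (if t $ j = s $ j then (if i = 0 then 1 else 0)
    else (y t i $ j - y s i $ j) / (t $ j - s $ j))" for i j
  define M where "M = (\<chi> a j. \<Sum>i\<le>k. w i j * C i $ a $ j)"
  have w0: "0 \<le> w i j" if "i \<le> k" for i j
    using mono[OF that, of s j t] mono[OF that, of t j s]
    by (auto simp: w_def divide_simps)
  have tot: "(\<Sum>i\<le>k. y u i $ j) = u $ j" for u j
    using arg_cong[OF total[of u], of "\<lambda>v. v $ j"] by simp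
  have w1: "(\<Sum>i\<le>k. w i j) = 1" for j
  proof (cases "t $ j = s $ j")
    case False
    then have "(\<Sum>i\<le>k. w i j) = (\<Sum>i\<le>k. y t i $ j - y s i $ j) / (t $ j - s $ j)"
      by (simp add: w_def sum_divide_distrib)
    then show ?thesis using False by (simp add: sum_subtractf tot)
  qed (simp add: w_def)
  have "0 < \<sigma> * det M"
    unfolding M_def by (rule det_convex_columns_pos[OF \<sigma> w0 w1])
  then have "invertible M" by (auto simp: invertible_det_nz)
  \<comment> \<open>If \<open>t $ j = s $ j\<close>, monotonicity in both directions makes the right
    side vanish as well.\<close>
  have step: "w i j * (t $ j - s $ j) = y t i $ j - y s i $ j" if "i \<le> k" for i j
    using mono[OF that, of s j t] mono[OF that, of t j s] by (auto simp: w_def)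
  have "M *v (t - s) = (\<Sum>i\<le>k. C i *v y t i) - (\<Sum>i\<le>k. C i *v y s i)"
  proof (rule vec_eq_iff[THEN iffD2], rule allI)
    fix a
    have "(M *v (t - s)) $ a = (\<Sum>j\<in>UNIV. \<Sum>i\<le>k. C i $ a $ j * (w i j * (t $ j - s $ j)))"
      by (simp add: M_def matrix_vector_mult_def sum_distrib_left sum_distrib_right mult_ac)
    also have "\<dots> = (\<Sum>i\<le>k. \<Sum>j\<in>UNIV. C i $ a $ j * (y t i $ j - y s i $ j))"
      by (subst sum.swap) (simp add: step)
    also have "\<dots> = ((\<Sum>i\<le>k. C i *v y t i) - (\<Sum>i\<le>k. C i *v y s i)) $ a"
      by (simp add: matrix_vector_mult_def sum_subtractf right_diff_distrib)
    finally show "(M *v (t - s)) $ a = ((\<Sum>i\<le>k. C i *v y t i) - (\<Sum>i\<le>k. C i *v y s i)) $ a" .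
  qed
  then have "M *v (t - s) = 0" using eq by simp
  then have "t - s = 0"
    using \<open>invertible M\<close> by (metis invertible_def matrix_left_invertible_ker)
  then show "s = t" by simp
qed

section \<open>Parametrization of the complementarity conditions\<close>

text \<open>
  The scalars \<open>(x 0, \<dots>, x k)\<close> with \<open>min (x 0) (x 1) = 0\<close> and \<open>min (c j - x j) (x (j + 1)) = 0\<close>
  form a polygonal line. Its point at \<open>t = x 1 + \<dots> + x k - x 0\<close> has \<open>x i = segment c k t i\<close> for
  \<open>i \<ge> 1\<close>; the sign at \<open>i = 0\<close> is reversed so that all components are increasing in \<open>t\<close> and
  their sum is \<open>t\<close>.
\<close>

definition segment :: "(nat \<Rightarrow> real) \<Rightarrow> nat \<Rightarrow> real \<Rightarrow> nat \<Rightarrow> real" where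
  "segment c k t i =
    (if i = 0 then min t 0
     else if i < k then max 0 (min (t - (\<Sum>j=1..<i. c j)) (c i))
     else max 0 (t - (\<Sum>j=1..<k. c j)))"

lemma segment_mono: "s \<le> t \<Longrightarrow> segment c k s i \<le> segment c k t i"
  by (auto simp: segment_def)

text \<open>The components with 1 \<le> i < k fill up in turn, so their partial sums are
  \<open>t\<close> clamped between 0 and the sum of the capacities. Index 0 supplies the negative
  part and index \<open>k\<close> the excess.\<close>

lemma sum_segment:
  assumes "1 \<le> k" and c: "\<And>j. j \<in> {1..<k} \<Longrightarrow> 0 < c j"
  shows "(\<Sum>i\<le>k. segment c k t i) = t"
proof -
  have part: "(\<Sum>i=1..<m. segment c k t i) = max 0 (min t (\<Sum>j=1..<m. c j))"
    if "1 \<le> m" "m \<le> k" for m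
    using that
  proof (induction m rule: dec_induct)
    case (step m)
    have "0 \<le> (\<Sum>j=1..<m. c j)" using c step by (intro sum_nonneg) (auto intro: less_imp_le)
    moreover have "0 < c m" using c step by auto
    moreover have "segment c k t m = max 0 (min (t - (\<Sum>j=1..<m. c j)) (c m))"
      using step by (simp add: segment_def)
    ultimately show ?case using step by (simp add: max_def min_def)
  qed simp
  have "0 \<le> (\<Sum>j=1..<k. c j)" using c by (intro sum_nonneg) (auto intro: less_imp_le)
  moreover have "{..k} = insert 0 (insert k {1..<k})" using assms(1) by auto
  ultimately show ?thesis
    using part[of k] assms(1) by (simp add: segment_def max_def min_def)
qed

text \<open>Component \<open>Suc j\<close> leaves 0 only beyond the value of \<open>t\<close> at
  which component \<open>j\<close> reaches its capacity \<open>c j\<close>.\<close>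

lemma segment_complementary:
  assumes "1 \<le> k" and c: "\<And>j. j \<in> {1..<k} \<Longrightarrow> 0 < c j"
  shows "min (- segment c k t 0) (segment c k t 1) = 0"
    and "j \<in> {1..<k} \<Longrightarrow> min (c j - segment c k t j) (segment c k t (Suc j)) = 0"
proof -
  show "min (- segment c k t 0) (segment c k t 1) = 0"
    using assms(1) c[of 1] by (cases "k = 1") (auto simp: segment_def min_def max_def)
  assume j: "j \<in> {1..<k}"
  then have "(\<Sum>j=1..<Suc j. c j) = (\<Sum>j=1..<j. c j) + c j" by simp
  moreover have "Suc j = k \<or> Suc j < k" using j by auto
  ultimately show "min (c j - segment c k t j) (segment c k t (Suc j)) = 0"
    using j c[of j] c[of "Suc j"] by (auto simp: segment_def min_def max_def)
qed

text \<open>An entry \<open>x (Suc m)\<close> can be positive only if \<open>x m = c m\<close>.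
  Hence all entries from index 1 up to a positive one are full, all after a non-full one are zero,
  and \<open>t\<close> determines the tuple.\<close>

lemma complementary_eq_segment:
  fixes x :: "nat \<Rightarrow> real"
  assumes "1 \<le> k" and c: "\<And>j. j \<in> {1..<k} \<Longrightarrow> 0 < c j"
    and x0: "min (x 0) (x 1) = 0"
    and xj: "\<And>j. j \<in> {1..<k} \<Longrightarrow> min (c j - x j) (x (Suc j)) = 0"
    and t: "t = (\<Sum>i=1..k. x i) - x 0"
  shows "segment c k t 0 = - x 0" and "1 \<le> i \<Longrightarrow> i \<le> k \<Longrightarrow> segment c k t i = x i"
proof -
  have nonneg: "0 \<le> x i" if "i \<le> k" for i
  proof (cases "i \<le> 1")
    case True
    then have "i = 0 \<or> i = 1" by auto
    then show ?thesis using x0 by (auto simp: min_def split: if_splits)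
  next
    case False
    then have "i - 1 \<in> {1..<k}" "Suc (i - 1) = i" using that by auto
    then show ?thesis using xj[of "i - 1"] by (auto simp: min_def split: if_splits)
  qed
  have le_c: "x i \<le> c i" if "i \<in> {1..<k}" for i
    using xj[OF that] by (auto simp: min_def split: if_splits)
  have step: "x (Suc m) = 0" if "m \<in> {1..<k}" "x m < c m" for m
    using xj[OF that(1)] that(2) by (auto simp: min_def split: if_splits)
  have above: "x m = 0" if "1 \<le> i" "x i < c i" "i < m" "m \<le> k" for i m
    using that(3,4)
  proof (induction m)
    case (Suc m)
    show ?case
    proof (cases "m = i")
      case True
      then show ?thesis using step[of i] that Suc.prems by simp
    next
      case False
      then show ?thesis using step[of m] c[of m] Suc that by simp
    qed
  qed simp
  have start: "x m = 0" if "0 < x 0" "1 \<le> m" "m \<le> k" for m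
  proof (cases "m = 1")
    case True
    then show ?thesis using x0 that by (auto simp: min_def split: if_splits)
  next
    case False
    have "x 1 = 0" using x0 that by (auto simp: min_def split: if_splits)
    then show ?thesis using above[of 1 m] c[of 1] that False by simp
  qed
  have split_sum: "(\<Sum>j=1..k. x j) = (\<Sum>j=1..<i. x j) + x i + (\<Sum>j\<in>{i<..k}. x j)"
    if "1 \<le> i" "i \<le> k" for i
  proof -
    have "{1..k} = insert i ({1..<i} \<union> {i<..k})" using that by auto
    moreover have "sum x ({1..<i} \<union> {i<..k}) = sum x {1..<i} + sum x {i<..k}"
      by (rule sum.union_disjoint) auto
    ultimately show ?thesis by simp
  qed
  show "segment c k t 0 = - x 0"
  proof (cases "0 < x 0")
    case True
    then have "(\<Sum>i=1..k. x i) = 0" using start by simp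
    then show ?thesis using True t by (simp add: segment_def)
  next
    case False
    then have "x 0 = 0" using nonneg[of 0] by simp
    moreover have "0 \<le> (\<Sum>i=1..k. x i)" using nonneg by (intro sum_nonneg) simp
    ultimately show ?thesis using t by (simp add: segment_def)
  qed
  assume i: "1 \<le> i" "i \<le> k"
  have tail0: "0 \<le> (\<Sum>j\<in>{i<..k}. x j)" using nonneg by (intro sum_nonneg) simp
  have pos: "t - (\<Sum>j=1..<i. c j) = x i + (\<Sum>j\<in>{i<..k}. x j)" if "0 < x i"
  proof -
    have "x 0 = 0" using start[of i] that i nonneg[of 0] by fastforce
    moreover have "x j = c j" if "j \<in> {1..<i}" for j
      using above[of j i] le_c[of j] that i \<open>0 < x i\<close> by fastforce
    ultimately show ?thesis using t split_sum[OF i] by simp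
  qed
  \<comment> \<open>Entries before a zero entry need not be full, so only an inequality holds; the
    truncation at 0 in \<open>segment\<close> makes it suffice.\<close>
  have zero: "t - (\<Sum>j=1..<i. c j) \<le> (\<Sum>j\<in>{i<..k}. x j)" if "x i = 0"
  proof -
    have "(\<Sum>j=1..<i. x j) \<le> (\<Sum>j=1..<i. c j)" using le_c i by (intro sum_mono) auto
    then show ?thesis using t split_sum[OF i] that nonneg[of 0] by simp
  qed
  show "segment c k t i = x i"
  proof (cases "i = k")
    case True
    then have "(\<Sum>j\<in>{i<..k}. x j) = 0" by simp
    then show ?thesis using pos zero nonneg[OF i(2)] True i by (fastforce simp: segment_def)
  next
    case False
    then have ik: "i \<in> {1..<k}" using i by simp
    have tail: "(\<Sum>j\<in>{i<..k}. x j) = 0" if "x i < c i"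
      using above[of i] that i by simp
    have seg: "segment c k t i = max 0 (min (t - (\<Sum>j=1..<i. c j)) (c i))"
      using ik by (simp add: segment_def)
    consider "x i = 0" | "0 < x i" "x i < c i" | "0 < x i" "x i = c i"
      using le_c[OF ik] nonneg[OF i(2)] by linarith
    then show ?thesis
    proof cases
      case 1
      then show ?thesis using seg zero tail c[OF ik] by simp
    next
      case 2
      then show ?thesis using seg pos tail by simp
    next
      case 3
      then show ?thesis using seg pos tail0 by simp
    qed
  qed
qed

section \<open>Coordinatewise parametrization of tuples by vectors\<close>

definition chain :: "nat \<Rightarrow> (nat \<Rightarrow> real^'n) \<Rightarrow> real^'n \<Rightarrow> nat \<Rightarrow> real^'n" where
  "chain k d t i = (\<chi> j. segment (\<lambda>m. d m $ j) k (t $ j) i)"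

text \<open>Undoes the sign reversal at index 0; the restriction to \<open>{..k}\<close> produces
  the extensional functions of which \<open>SOL\<close> consists.\<close>

definition tuple :: "nat \<Rightarrow> (nat \<Rightarrow> real^'n) \<Rightarrow> real^'n \<Rightarrow> nat \<Rightarrow> real^'n" where
  "tuple k d t = (\<lambda>i\<in>{..k}. if i = 0 then - chain k d t 0 else chain k d t i)"

definition param :: "nat \<Rightarrow> (nat \<Rightarrow> real^'n) \<Rightarrow> real^'n" where
  "param k x = (\<Sum>i=1..k. x i) - x 0"

lemma continuous_on_chain: "continuous_on S (\<lambda>t. chain k d t i)"
  unfolding chain_def segment_def
  by (cases "i = 0"; cases "i < k")
    (auto intro!: continuous_on_vec_lambda continuous_on_min continuous_on_max continuous_intros)

lemma continuous_on_tuple: "continuous_on S (tuple k d)"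
proof (rule continuous_on_coordinatewise_then_product)
  show "continuous_on S (\<lambda>t. tuple k d t i)" for i
    by (cases "i \<le> k"; cases "i = 0")
      (auto simp: tuple_def intro!: continuous_intros continuous_on_chain)
qed

lemma continuous_on_param: "continuous_on S (param k)"
  unfolding param_def
  by (intro continuous_intros continuous_on_subset[OF continuous_on_product_coordinates]) auto

lemma bounded_param_image:
  assumes "bounded_tuples k T"
  shows "bounded (param k ` T)"
proof -
  have "\<exists>B. \<forall>x\<in>T. norm (x i) \<le> B" if "i \<le> k" for i
    using assms that by (auto simp: bounded_tuples_def bounded_iff)
  then obtain B where B: "\<And>i x. i \<le> k \<Longrightarrow> x \<in> T \<Longrightarrow> norm (x i) \<le> B i" by metis
  have "norm (param k x) \<le> (\<Sum>i=1..k. B i) + B 0" if "x \<in> T" for x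
  proof -
    have "norm (param k x) \<le> norm (\<Sum>i=1..k. x i) + norm (x 0)"
      unfolding param_def by (rule norm_triangle_ineq4)
    also have "\<dots> \<le> (\<Sum>i=1..k. B i) + B 0"
      using B that by (intro add_mono sum_norm_le) auto
    finally show ?thesis .
  qed
  then show ?thesis by (auto simp: bounded_iff)
qed

lemma sum_atMost_split:
  fixes f :: "nat \<Rightarrow> 'b::comm_monoid_add"
  shows "(\<Sum>i\<le>k. f i) = f 0 + (\<Sum>i=1..k. f i)"
  by (simp add: atMost_atLeast0 sum.atLeast_Suc_atMost)

lemma inf_vec_eq_0_iff:
  fixes u v :: "real^'n"
  shows "inf u v = 0 \<longleftrightarrow> (\<forall>j. min (u $ j) (v $ j) = 0)"
  by (simp add: vec_eq_iff inf_vec_def inf_min)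

context
  fixes k :: nat and d :: "nat \<Rightarrow> real^'n"
  assumes k: "1 \<le> k" and d: "\<And>j i. j \<in> {1..<k} \<Longrightarrow> 0 < d j $ i"
begin

lemma sum_chain: "(\<Sum>i\<le>k. chain k d t i) = t"
  using sum_segment[OF k, of "\<lambda>m. d m $ _"] d by (simp add: vec_eq_iff chain_def)

lemma param_tuple: "param k (tuple k d t) = t"
  using sum_chain[of t] k by (simp add: param_def tuple_def sum_atMost_split add.commute)

text \<open>Complementarity holds along the whole polygonal line, so only the linear equation
  remains; the sign reversal at index 0 merges its two sides into one sum.\<close>

lemma tuple_in_SOL_iff:
  "tuple k d t \<in> SOL k C d q \<longleftrightarrow> (\<Sum>i\<le>k. C i *v chain k d t i) = - q"
proof -
  have "inf (tuple k d t 0) (tuple k d t 1) = 0"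
    using segment_complementary(1)[OF k, of "\<lambda>m. d m $ _"] d k
    by (simp add: inf_vec_eq_0_iff tuple_def chain_def)
  moreover have "inf (d j - tuple k d t j) (tuple k d t (Suc j)) = 0" if "j \<in> {1..<k}" for j
    using segment_complementary(2)[OF k, of "\<lambda>m. d m $ _" j] d that
    by (simp add: inf_vec_eq_0_iff tuple_def chain_def)
  moreover have "tuple k d t \<in> {..k} \<rightarrow>\<^sub>E UNIV"
    by (simp add: tuple_def)
  ultimately have "tuple k d t \<in> SOL k C d q \<longleftrightarrow>
      C 0 *v tuple k d t 0 = q + (\<Sum>i=1..k. C i *v tuple k d t i)"
    by (simp add: SOL_def)
  also have "\<dots> \<longleftrightarrow> - (C 0 *v chain k d t 0) = q + (\<Sum>i=1..k. C i *v chain k d t i)"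
    by (simp add: tuple_def vec.neg)
  also have "\<dots> \<longleftrightarrow> (\<Sum>i\<le>k. C i *v chain k d t i) = - q"
    unfolding sum_atMost_split by (auto simp: algebra_simps eq_neg_iff_add_eq_0 neg_eq_iff_add_eq_0)
  finally show ?thesis .
qed

lemma tuple_param:
  assumes "x \<in> SOL k C d q"
  shows "tuple k d (param k x) = x"
proof
  fix i
  have *: "x \<in> extensional {..k}" "inf (x 0) (x 1) = 0"
    "\<And>j. j \<in> {1..<k} \<Longrightarrow> inf (d j - x j) (x (Suc j)) = 0"
    using assms by (auto simp: SOL_def PiE_def)
  show "tuple k d (param k x) i = x i"
  proof (cases "i \<le> k")
    case True
    have "segment (\<lambda>m. d m $ j) k (param k x $ j) 0 = - x 0 $ j"
      and "1 \<le> i \<Longrightarrow> segment (\<lambda>m. d m $ j) k (param k x $ j) i = x i $ j" for j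
      using complementary_eq_segment(1)[OF k, of "\<lambda>m. d m $ j" "\<lambda>i. x i $ j" "param k x $ j"]
        complementary_eq_segment(2)[OF k, of "\<lambda>m. d m $ j" "\<lambda>i. x i $ j" "param k x $ j" i]
        d * True by (auto simp: inf_vec_eq_0_iff param_def)
    then show ?thesis using True by (simp add: tuple_def chain_def vec_eq_iff)
  qed (use * in \<open>simp add: tuple_def extensional_def\<close>)
qed

end

section \<open>Connectedness of the solution set\<close>

theorem theorem5p4:
  fixes k :: nat
    and C :: "nat \<Rightarrow> real^'n^'n"
    and d :: "nat \<Rightarrow> real^'n"
    and q :: "real^'n"
  assumes "k \<ge> 1"
    and "column_W0 k C"
    and "\<And>j i. j \<in> {1..<k} \<Longrightarrow> d j $ i > 0"
    and "\<exists>T \<in> components (SOL k C d q). bounded_tuples k T"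
  shows "connected (SOL k C d q)"
proof -
  \<comment> \<open>\<open>G\<close> is linear in \<open>A\<close>, so perturbing \<open>C\<close>
    by \<open>\<epsilon>\<close> times \<open>N\<close> adds \<open>\<epsilon>\<close> times
    \<open>G N\<close>.\<close>
  define G where "G A t = (\<Sum>i\<le>k. A i *v chain k d t i)" for A :: "nat \<Rightarrow> real^'n^'n" and t
  have cont: "continuous_on S (G A)" for S A
    unfolding G_def
    by (intro continuous_intros continuous_on_chain
        linear_continuous_on_compose[OF _ matrix_vector_mul_linear])
  let ?S = "SOL k C d q" and ?Z = "{t. G C t = - q}"
  have pt: "param k (tuple k d t) = t" for t
    by (rule param_tuple) (use assms(1,3) in auto)
  have tp: "tuple k d (param k x) = x" if "x \<in> ?S" for x
    by (rule tuple_param[OF _ _ that]) (use assms(1,3) in auto)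
  have Z: "t \<in> ?Z \<longleftrightarrow> tuple k d t \<in> ?S" for t
    using tuple_in_SOL_iff[of k d t C q] assms(1,3) by (simp add: G_def)
  have S_image: "tuple k d ` ?Z = ?S"
  proof
    show "tuple k d ` ?Z \<subseteq> ?S" using Z by blast
    show "?S \<subseteq> tuple k d ` ?Z"
    proof
      fix x assume "x \<in> ?S"
      then have "tuple k d (param k x) = x" by (rule tp)
      with \<open>x \<in> ?S\<close> show "x \<in> tuple k d ` ?Z" using Z[of "param k x"] by (metis imageI)
    qed
  qed
  have Z_image: "param k ` ?S = ?Z"
    unfolding S_image[symmetric] image_image pt by simp
  obtain N :: "nat \<Rightarrow> real^'n^'n" where N: "\<And>\<epsilon>. 0 < \<epsilon> \<Longrightarrow> column_W k (\<lambda>i. C i + \<epsilon> *\<^sub>R N i)"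
    using assms(2) by (auto simp: column_W0_def)
  have approx: "\<exists>g. continuous_on UNIV g \<and> inj g \<and> (\<forall>x\<in>S. dist (g x) (G C x) < e)"
    if "compact S" "0 < e" for S e
  proof -
    have "bounded (G N ` S)"
      using compact_continuous_image[OF cont that(1)] by (rule compact_imp_bounded)
    then obtain B where B: "0 < B" "\<And>x. x \<in> S \<Longrightarrow> norm (G N x) \<le> B"
      by (auto simp: bounded_pos)
    \<comment> \<open>This keeps the perturbation at most \<open>e / 2\<close> on
      \<open>S\<close>.\<close>
    define \<epsilon> where "\<epsilon> = e / (2 * B)"
    have "0 < \<epsilon>" using B that by (simp add: \<epsilon>_def)
    let ?g = "G (\<lambda>i. C i + \<epsilon> *\<^sub>R N i)"
    have "inj ?g"
      unfolding G_def
    proof (rule column_W_inj[OF N[OF \<open>0 < \<epsilon>\<close>]])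
      show "(\<Sum>i\<le>k. chain k d t i) = t" for t
        by (rule sum_chain) (use assms(1,3) in auto)
    qed (simp add: chain_def segment_mono)
    moreover have "dist (?g x) (G C x) < e" if "x \<in> S" for x
    proof -
      have "?g x - G C x = \<epsilon> *\<^sub>R G N x"
        by (simp add: G_def matrix_vector_mult_add_rdistrib sum.distrib scaleR_sum_right
            scaleR_matrix_vector_assoc)
      then have "dist (?g x) (G C x) = \<epsilon> * norm (G N x)"
        using \<open>0 < \<epsilon>\<close> by (simp add: dist_norm)
      also have "\<dots> \<le> \<epsilon> * B" using B(2)[OF that] \<open>0 < \<epsilon>\<close> by simp
      also have "\<dots> < e" using B(1) \<open>0 < e\<close> by (simp add: \<epsilon>_def)
      finally show ?thesis .
    qed
    ultimately show ?thesis using cont by blast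
  qed
  obtain T where T: "T \<in> components ?S" "bounded_tuples k T"
    using assms(4) by blast
  have T': "T \<noteq> {}" "T \<subseteq> ?S" "connected T"
    "\<And>D. D \<noteq> {} \<Longrightarrow> T \<subseteq> D \<Longrightarrow> D \<subseteq> ?S \<Longrightarrow> connected D \<Longrightarrow> D = T"
    using T(1) unfolding in_components_maximal by simp_all
  \<comment> \<open>\<open>param k\<close> and \<open>tuple k d\<close> are mutually inverse and
    continuous between \<open>?S\<close> and \<open>?Z\<close>, so components correspond; maximality
    is checked by mapping \<open>D\<close> back to \<open>?S\<close>.\<close>
  have "param k ` T \<in> components ?Z"
    unfolding in_components_maximal
  proof (intro conjI allI impI)
    show "param k ` T \<noteq> {}" "param k ` T \<subseteq> ?Z"
      using T'(1,2) Z_image by auto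
    show "connected (param k ` T)"
      by (rule connected_continuous_image[OF continuous_on_param T'(3)])
    fix D assume D: "D \<noteq> {} \<and> param k ` T \<subseteq> D \<and> D \<subseteq> ?Z \<and> connected D"
    have "tuple k d ` D = T"
    proof (rule T'(4))
      show "T \<subseteq> tuple k d ` D"
      proof
        fix x assume "x \<in> T"
        then have "x = tuple k d (param k x)" using tp T'(2) by (metis subsetD)
        then show "x \<in> tuple k d ` D" using D \<open>x \<in> T\<close> by blast
      qed
      show "connected (tuple k d ` D)"
        using D by (intro connected_continuous_image[OF continuous_on_tuple]) simp
      show "tuple k d ` D \<noteq> {}" using D by simp
      show "tuple k d ` D \<subseteq> ?S" using D S_image by blast
    qed
    then show "D = param k ` T" by (auto simp: image_image pt)
  qed
  then have "connected ?Z"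
    using connected_vimage_of_injective_limit[OF cont approx] bounded_param_image[OF T(2)] by simp
  then show ?thesis
    using connected_continuous_image[OF continuous_on_tuple, of ?Z k d] S_image by simp
qed

end
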